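(* Let $p(x)\in\mathbb{Z}[x]$. For integers $n,k,r$ with $r\ge 0$, $n\ge r$ and $k\ge 1$, $$\sum_{j=r}^n\bigl([p(j)]_q\bigr)^k=-\sum_{\ell=1}^{n-r+1}\ell\, s_{n+1,n+1-\ell,r}^{p(x)}(q)\,S_{n+k-\ell,n,r}^{p(x)}(q).$$
   Context: Here $q$ is an indeterminate and $[m]_q=\frac{q^m-1}{q-1}$ for $m\in\mathbb{Z}$. The type II $q,r$-poly-Stirling numbers of the second kind are defined by $S_{r,r,r}^{p(x)}(q)=1$, $S_{n,k,r}^{p(x)}(q)=0$ for $k<r$, $k>n$ or $n<r$, and $S_{n,k,r}^{p(x)}(q)=S_{n-1,k-1,r}^{p(x)}(q)+[p(k)]_q S_{n-1,k,r}^{p(x)}(q)$ for $r\le k\le n$, $n>r$. The type II signed $q,r$-poly-Stirling numbers of the first kind are defined by $s_{r,r,r}^{p(x)}(q)=1$, $s_{n,k,r}^{p(x)}(q)=0$ for $k<r$, $k>n$ or $n<r$, and $s_{n,k,r}^{p(x)}(q)=s_{n-1,k-1,r}^{p(x)}(q)-[p(n-1)]_q s_{n-1,k,r}^{p(x)}(q)$ for $r\le k\le n$, $n>r$. *)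

theory Defs
  imports "HOL-Computational_Algebra.Polynomial" "HOL-Computational_Algebra.Fraction_Field"
begin

text \<open>
  The indeterminate \<open>q\<close> (\<open>qvar\<close>) lives in the field of fractions of \<open>\<int>[q]\<close>, since \<open>[m]\<^sub>q\<close> with
  negative \<open>m\<close> is a Laurent polynomial.
\<close>

definition qvar :: "int poly fract" where
  "qvar = Fract [:0, 1:] 1"

definition qint :: "int \<Rightarrow> int poly fract" where
  "qint m = (qvar powi m - 1) / (qvar - 1)"

text \<open>
  \<open>qS2 p n k r\<close> is the type II \<open>q,r\<close>-poly-Stirling number of the second kind, \<open>qs1 p n k r\<close>
  the signed one of the first kind.  All indices are integers, so that index subtraction is not truncated.  In both recursions the
  first case leaves \<open>r \<le> k \<le> n\<close>; there \<open>n = r\<close> forces \<open>k = r\<close>, so the second case is the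
  initial value at \<open>(r, r, r)\<close>.
\<close>

function qS2 :: "int poly \<Rightarrow> int \<Rightarrow> int \<Rightarrow> int \<Rightarrow> int poly fract" where
  "qS2 p n k r =
     (if k < r \<or> k > n \<or> n < r then 0
      else if n = r then 1
      else qS2 p (n - 1) (k - 1) r + qint (poly p k) * qS2 p (n - 1) k r)"
  by auto
termination by (relation "measure (\<lambda>(p, n, k, r). nat (n - r))") auto

function qs1 :: "int poly \<Rightarrow> int \<Rightarrow> int \<Rightarrow> int \<Rightarrow> int poly fract" where
  "qs1 p n k r =
     (if k < r \<or> k > n \<or> n < r then 0
      else if n = r then 1
      else qs1 p (n - 1) (k - 1) r - qint (poly p (n - 1)) * qs1 p (n - 1) k r)"
  by auto
termination by (relation "measure (\<lambda>(p, n, k, r). nat (n - r))") auto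

declare qS2.simps [simp del] qs1.simps [simp del]

end

theory Submission
  imports Defs "HOL-Computational_Algebra.Formal_Power_Series"
begin

text \<open>
  The identity is one of Newton's identities, in generating-function form, for the finitely many
  quantities \<open>x\<^sub>j = [p(j)]\<^sub>q\<close> with \<open>r \<le> j \<le> n\<close>.  Put \<open>E(X) = \<Prod>\<^sub>j (1 - x\<^sub>j X)\<close>.
  Up to sign, the Stirling numbers of the first kind are the elementary symmetric functions of
  the \<open>x\<^sub>j\<close>: reading their recursion as multiplication by a linear factor, the coefficient of
  \<open>X^l\<close> in \<open>E\<close> is the number with indices \<open>n + 1\<close> and \<open>n + 1 - l\<close> (\<open>prod_linear_nth_eq_qs1\<close>).
  Those of the second kind are the complete homogeneous ones: their recursion is division by a
  linear factor, so \<open>1 / E\<close> has as coefficient of \<open>X^d\<close> the number with indices \<open>n + d\<close> and \<open>n\<close>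
  (\<open>prod_linear_mult_qS2_gf\<close>).

  The generating function of the power sums is \<open>\<Sum>\<^sub>j x\<^sub>j X / (1 - x\<^sub>j X)\<close>, which is \<open>- X E' / E\<close>
  by logarithmic differentiation (\<open>X_mult_deriv_prod_linear\<close>).  Comparing coefficients of \<open>X^k\<close>
  gives the theorem; the factor \<open>l\<close> comes from the derivative.
\<close>

unbundle fps_syntax

section \<open>Logarithmic derivative of a product of linear factors\<close>

definition positive_powers_gf :: "'a::comm_ring_1 \<Rightarrow> 'a fps" where
  "positive_powers_gf c = Abs_fps (\<lambda>k. if k = 0 then 0 else c ^ k)"

lemma one_minus_cX_mult_nth:
  fixes c :: "'a::comm_ring_1"
  shows "((1 - fps_const c * fps_X) * f) $ m = f $ m - (if m = 0 then 0 else c * f $ (m - 1))"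
  by (simp add: left_diff_distrib mult.assoc)

lemma one_minus_cX_mult_positive_powers_gf:
  fixes c :: "'a::comm_ring_1"
  shows "(1 - fps_const c * fps_X) * positive_powers_gf c = fps_const c * fps_X"
proof (rule fps_ext)
  fix m
  show "((1 - fps_const c * fps_X) * positive_powers_gf c) $ m = (fps_const c * fps_X) $ m"
    unfolding one_minus_cX_mult_nth
    by (cases m) (auto simp: positive_powers_gf_def fps_X_def)
qed

text \<open>
  Each factor contributes \<open>X (1 - c X)' / (1 - c X) = - c X / (1 - c X)\<close> to the logarithmic
  derivative; multiplying through by the product keeps the statement free of division.
\<close>
lemma X_mult_deriv_prod_linear:
  fixes c :: "'b \<Rightarrow> 'a::comm_ring_1"
  assumes "finite A"
  shows "fps_X * fps_deriv (\<Prod>j\<in>A. 1 - fps_const (c j) * fps_X) =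
    - ((\<Prod>j\<in>A. 1 - fps_const (c j) * fps_X) * (\<Sum>j\<in>A. positive_powers_gf (c j)))"
  using assms
proof (induction A rule: finite_induct)
  case empty
  show ?case by simp
next
  case (insert a A)
  define P where "P = (\<Prod>j\<in>A. 1 - fps_const (c j) * fps_X)"
  define G where "G = (\<Sum>j\<in>A. positive_powers_gf (c j))"
  define L where "L = 1 - fps_const (c a) * fps_X"
  have deriv_L: "fps_X * fps_deriv L = - (L * positive_powers_gf (c a))"
    unfolding L_def one_minus_cX_mult_positive_powers_gf
    by (simp add: mult.commute flip: fps_const_neg)
  have IH: "fps_X * fps_deriv P = - (P * G)"
    using insert.IH by (simp add: P_def G_def)
  have "fps_X * fps_deriv (L * P) = (fps_X * fps_deriv L) * P + L * (fps_X * fps_deriv P)"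
    by (simp add: algebra_simps)
  also have "\<dots> = - ((L * P) * (positive_powers_gf (c a) + G))"
    unfolding deriv_L IH by (simp add: algebra_simps)
  finally show ?case
    using insert.hyps by (simp add: P_def G_def L_def)
qed

section \<open>Generating functions of the Stirling numbers\<close>

lemma qs1_eq_0: "k < r \<or> k > n \<Longrightarrow> qs1 p n k r = 0"
  by (subst qs1.simps) auto

lemma qS2_eq_0: "k < r \<or> k > n \<Longrightarrow> qS2 p n k r = 0"
  by (subst qS2.simps) auto

lemma qs1_base: "qs1 p r r r = 1"
  by (subst qs1.simps) auto

lemma qS2_base: "qS2 p r r r = 1"
  by (subst qS2.simps) auto

text \<open>
  Because of the zero boundary values the recursions hold for every \<open>k\<close>, so that the
  generating functions can be handled without distinguishing ranges of the coefficients.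
\<close>
lemma qs1_rec:
  assumes "n \<ge> r"
  shows "qs1 p (n + 1) k r = qs1 p n (k - 1) r - qint (poly p n) * qs1 p n k r"
proof (cases "k < r \<or> k > n + 1")
  case True
  then show ?thesis by (auto simp: qs1_eq_0)
next
  case False
  then show ?thesis using assms by (subst qs1.simps) auto
qed

lemma qS2_rec:
  assumes "n \<ge> r"
  shows "qS2 p (n + 1) k r = qS2 p n (k - 1) r + qint (poly p k) * qS2 p n k r"
proof (cases "k < r \<or> k > n + 1")
  case True
  then show ?thesis by (auto simp: qS2_eq_0)
next
  case False
  then show ?thesis using assms by (subst qS2.simps) auto
qed

abbreviation qint_factor :: "int poly \<Rightarrow> int \<Rightarrow> int poly fract fps" where
  "qint_factor p j \<equiv> 1 - fps_const (qint (poly p j)) * fps_X"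

definition qS2_gf :: "int poly \<Rightarrow> int \<Rightarrow> int \<Rightarrow> int poly fract fps" where
  "qS2_gf p n r = Abs_fps (\<lambda>d. qS2 p (n + int d) n r)"

lemma prod_linear_nth_eq_qs1:
  assumes "n \<ge> r"
  shows "(\<Prod>j = r..<n. qint_factor p j) $ l = qs1 p n (n - int l) r"
  using assms
proof (induction n arbitrary: l rule: int_ge_induct)
  case base
  show ?case by (cases l) (simp_all add: qs1_base qs1_eq_0)
next
  case (step n)
  have "{r..<n + 1} = insert n {r..<n}" using step.hyps by auto
  then have "(\<Prod>j = r..<n + 1. qint_factor p j) = qint_factor p n * (\<Prod>j = r..<n. qint_factor p j)"
    by simp
  then have "(\<Prod>j = r..<n + 1. qint_factor p j) $ l =
      qs1 p n (n - int l) r - (if l = 0 then 0 else qint (poly p n) * qs1 p n (n - int (l - 1)) r)"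
    by (simp only: one_minus_cX_mult_nth step.IH)
  also have "\<dots> = qs1 p (n + 1) (n + 1 - int l) r"
    using step.hyps by (cases l) (simp_all add: qs1_rec qs1_eq_0 diff_diff_eq add.commute[of 1])
  finally show ?case .
qed

lemma qint_factor_mult_qS2_gf_base: "qint_factor p r * qS2_gf p r r = 1"
proof (rule fps_ext)
  fix d
  show "(qint_factor p r * qS2_gf p r r) $ d = (1 :: int poly fract fps) $ d"
    unfolding one_minus_cX_mult_nth qS2_gf_def
  proof (cases d)
    case (Suc e)
    have "qS2 p (r + int e + 1) r r = qint (poly p r) * qS2 p (r + int e) r r"
      by (simp add: qS2_rec qS2_eq_0)
    then show "Abs_fps (\<lambda>d. qS2 p (r + int d) r r) $ d - (if d = 0 then 0
        else qint (poly p r) * Abs_fps (\<lambda>d. qS2 p (r + int d) r r) $ (d - 1)) = 1 $ d"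
      using Suc by (simp add: add_ac)
  qed (simp add: qS2_base)
qed

lemma qint_factor_mult_qS2_gf_step:
  assumes "n \<ge> r"
  shows "qint_factor p (n + 1) * qS2_gf p (n + 1) r = qS2_gf p n r"
proof (rule fps_ext)
  fix d
  have rec: "qS2 p (n + int d + 1) (n + 1) r =
      qS2 p (n + int d) n r + qint (poly p (n + 1)) * qS2 p (n + int d) (n + 1) r"
    using assms by (simp add: qS2_rec)
  show "(qint_factor p (n + 1) * qS2_gf p (n + 1) r) $ d = qS2_gf p n r $ d"
    unfolding one_minus_cX_mult_nth qS2_gf_def
    using rec by (cases d) (simp_all add: add_ac qS2_eq_0)
qed

lemma prod_linear_mult_qS2_gf:
  assumes "n \<ge> r"
  shows "(\<Prod>j = r..n. qint_factor p j) * qS2_gf p n r = 1"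
  using assms
proof (induction n rule: int_ge_induct)
  case base
  show ?case by (simp add: qint_factor_mult_qS2_gf_base)
next
  case (step n)
  have "{r..n + 1} = insert (n + 1) {r..n}" using step.hyps by auto
  then have "(\<Prod>j = r..n + 1. qint_factor p j) * qS2_gf p (n + 1) r =
      (\<Prod>j = r..n. qint_factor p j) * (qint_factor p (n + 1) * qS2_gf p (n + 1) r)"
    by (simp add: mult_ac)
  then show ?case
    using step by (simp only: qint_factor_mult_qS2_gf_step)
qed

section \<open>Power sums\<close>

theorem theorem6p3:
  fixes p :: "int poly" and n k r :: int
  assumes "r \<ge> 0" and "n \<ge> r" and "k \<ge> 1"
  shows "(\<Sum>j = r..n. qint (poly p j) powi k) =
    - (\<Sum>l = 1..n - r + 1. of_int l * qs1 p (n + 1) (n + 1 - l) r * qS2 p (n + k - l) n r)"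
proof -
  define K where "K = nat k"
  have K: "int K = k" "K \<noteq> 0" using assms by (auto simp: K_def)
  define E where "E = (\<Prod>j = r..n. qint_factor p j)"
  define G where "G = (\<Sum>j = r..n. positive_powers_gf (qint (poly p j)))"
  define summand where
    "summand l = of_int l * qs1 p (n + 1) (n + 1 - l) r * qS2 p (n + k - l) n r" for l :: int
  have "{r..n} = {r..<n + 1}" by auto
  then have E_nth: "E $ l = qs1 p (n + 1) (n + 1 - int l) r" for l
    using prod_linear_nth_eq_qs1[of r "n + 1" p l] assms by (simp add: E_def)
  have XE'_nth: "(fps_X * fps_deriv E) $ l = of_nat l * E $ l" for l
    by (cases l) simp_all
  have "fps_X * fps_deriv E = - (E * G)"
    unfolding E_def G_def by (rule X_mult_deriv_prod_linear) simp
  then have "(fps_X * fps_deriv E) * qS2_gf p n r = - ((E * qS2_gf p n r) * G)"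
    by (simp add: mult_ac)
  then have G_eq: "G = - ((fps_X * fps_deriv E) * qS2_gf p n r)"
    using prod_linear_mult_qS2_gf[of r n p] assms by (simp add: E_def)
  have "(\<Sum>j = r..n. qint (poly p j) powi k) = G $ K"
    using K by (simp add: G_def fps_sum_nth positive_powers_gf_def flip: K(1))
  also have "\<dots> = - (\<Sum>i = 0..K. summand (int i))"
    unfolding G_eq fps_neg_nth fps_mult_nth[of "fps_X * fps_deriv E"] XE'_nth E_nth summand_def qS2_gf_def
    using K(1) by (intro arg_cong[of _ _ uminus] sum.cong) (auto simp: of_nat_diff algebra_simps)
  also have "(\<Sum>i = 0..K. summand (int i)) = (\<Sum>l\<in>int ` {0..K}. summand l)"
    by (simp add: sum.reindex)
  also have "int ` {0..K} = {0..k}"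
    using K(1) by (simp add: image_int_atLeastAtMost)
  \<comment> \<open>The two ranges of \<open>l\<close> differ, but outside either one the summand vanishes: through its
     first factor at \<open>l = 0\<close>, and through a Stirling number for \<open>l > n - r + 1\<close> or \<open>l > k\<close>.\<close>
  also have "(\<Sum>l\<in>{0..k}. summand l) = (\<Sum>l\<in>{0..k} \<inter> {1..n - r + 1}. summand l)"
    by (rule sum.mono_neutral_right) (auto simp: summand_def qs1_eq_0 intro!: qs1_eq_0)
  also have "\<dots> = (\<Sum>l\<in>{1..n - r + 1}. summand l)"
    by (rule sum.mono_neutral_left) (auto simp: summand_def intro!: qS2_eq_0)
  finally show ?thesis by (simp add: summand_def)
qed

end
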